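(* Let $p,\beta>0$, $q\in\mathbb{R}^2$ and let $A\in\mathbb{R}^{2\times2}$ be a symmetric positive definite matrix with condition number $\kappa>1$ and eigenvalue decomposition $$A = V^T\Lambda V,\quad V^TV=VV^T=I_2,\quad \Lambda=\mathrm{diag}(\lambda_1,\lambda_2),\quad \lambda_1>\lambda_2>0.$$ Define $$\tilde q := Vq,\quad s := \mathrm{sign}(\tilde q),\quad \bar q := |\tilde q|,\quad \overline\beta := \frac{\beta}{\lambda_2^{p/2}},\quad \overline\Lambda := \mathrm{diag}(\kappa,1),\quad \kappa=\frac{\lambda_1}{\lambda_2}.$$ Then any solution $t^*\in\mathbb{R}^2$ of the problem $$t^*\in\operatorname*{arg\,min}_{t\in\mathbb{R}^2}\left\{F(t) := (t^TAt)^{p/2}+\frac{\beta}{2}\|t-q\|_2^2\right\}$$ can be expressed as $$t^* = V^T(s\circ z^* ),\qquad z^*\in\operatorname*{arg\,min}_{z\in\mathcal{H}_1} H(z),$$ where the objective function $H:\mathbb{R}^2\to\mathbb{R}$ and the feasible set $\mathcal{H}_1\subset\mathbb{R}^2$ are defined by $$H(z) := (z^T\,\overline\Lambda\,z)^{p/2}+\frac{\overline\beta}{2}\|z-\bar q\|_2^2,\qquad \mathcal{H}_1 := \mathcal{H}\cap\big([0,\bar q_1]\times[0,\bar q_2]\big),$$ with $\mathcal{H}$ the rectangular hyperbola $$\mathcal{H} := \left\{(z_1,z_2)\in\mathbb{R}^2 : (z_1-c_1)(z_2-c_2)=c_1c_2\right\},\qquad c_1=-\frac{\bar q_1}{\kappa-1},\quad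 c_2=\frac{\kappa\,\bar q_2}{\kappa-1}.$$
   Context: For $v,w\in\mathbb{R}^n$, $v\circ w$ denotes the component-wise (Hadamard) product, and $|v|$ and $\mathrm{sign}(v)$ denote the component-wise absolute value and sign of $v$ (with the usual convention $\mathrm{sign}(0)=0$). $\operatorname{arg\,min}$ denotes the set of global minimisers over the indicated set. *)

theory Defs
  imports "HOL-Analysis.Analysis"
begin

definition sym_pos_def :: "real^'n^'n \<Rightarrow> bool" where
  "sym_pos_def A \<longleftrightarrow> transpose A = A \<and> (\<forall>x. x \<noteq> 0 \<longrightarrow> x \<bullet> (A *v x) > 0)"

definition diag :: "real^'n \<Rightarrow> real^'n^'n" where
  "diag d = (\<chi> i j. if i = j then d $ i else 0)"

(* The library's sgn on real^'n is the normalisation x /\<^sub>R norm x, hence a separate constant.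
   The library's multiplication and absolute value on real^'n, in contrast, are componentwise
   and serve as the Hadamard product and |v|. *)
definition vec_sign :: "real^'n \<Rightarrow> real^'n" where
  "vec_sign v = (\<chi> i. sgn (v $ i))"

(* With parameters (p, beta, A, q) this is F; with the transformed parameters it is H.
   For positive semidefinite A the base of powr is nonnegative, and 0 powr (p/2) = 0. *)
definition objective :: "real \<Rightarrow> real \<Rightarrow> real^'n^'n \<Rightarrow> real^'n \<Rightarrow> real^'n \<Rightarrow> real" where
  "objective p \<beta> A q t = (t \<bullet> (A *v t)) powr (p / 2) + \<beta> / 2 * (norm (t - q))\<^sup>2"

definition hyperbola :: "real \<Rightarrow> real \<Rightarrow> (real^2) set" where
  "hyperbola c\<^sub>1 c\<^sub>2 = {z. (z $ 1 - c\<^sub>1) * (z $ 2 - c\<^sub>2) = c\<^sub>1 * c\<^sub>2}"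

end

theory Submission
  imports Defs
begin

text \<open>
  In the coordinates $y = V t$, and after dividing by $\lambda_2^{p/2}$, the objective becomes the
  objective with matrix $\mathrm{diag}(\kappa, 1)$ and anchor $\tilde q$
  (\<open>objective_orthogonal_change\<close>, \<open>objective_scale\<close>). Let $y$ be a global minimiser of it.

  Moving $y$ to its nearest point in the box of all points lying componentwise between $0$ and
  $\tilde q$ does not increase the quadratic form, and strictly decreases the distance to $\tilde q$
  unless $y$ is already in the box. So $y$ has the signs of $\tilde q$ and $|y| \le |\tilde q|$
  (\<open>minimiser_box\<close>), and $z = |y|$ is the candidate for $z^*$. On the box $0 \le z \le |\tilde q|$,
  multiplication by the signs turns $H$ into the objective of $y$ (\<open>objective_diag_sign\<close>), so $z$
  minimises $H$ there, and a fortiori on any subset that contains $z$.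

  It remains to see that $z$ lies on the hyperbola. The quadratic form, and with it its power, is
  constant on the ellipse $\kappa x_1^2 + x_2^2 = \mathrm{const}$ through $y$, so $y$ is a nearest
  point to $\tilde q$ on that ellipse, and $y - \tilde q$ is orthogonal to the tangent
  (\<open>minimiser_tangency\<close>). After the signs have been removed, this orthogonality is the equation of
  the hyperbola. Only the squared distance is differentiated, never the power $p/2$; hence the
  origin, where the power need not be differentiable, needs no separate treatment.
\<close>

lemma inner_diag: "x \<bullet> (diag d *v x) = (\<Sum>i\<in>UNIV. d $ i * (x $ i)\<^sup>2)"
proof -
  have "(diag d *v x) $ i = d $ i * x $ i" for i
    by (simp add: diag_def matrix_vector_mult_def if_distrib[where f="\<lambda>a. a * _"] cong: if_cong)
  thus ?thesis by (simp add: inner_vec_def power2_eq_square mult_ac)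
qed

lemma norm_diff_power2:
  fixes x y :: "real^'n"
  shows "(norm (x - y))\<^sup>2 = (\<Sum>i\<in>UNIV. (x $ i - y $ i)\<^sup>2)"
  by (simp add: power2_norm_eq_inner inner_vec_def flip: power2_eq_square)

lemma norm_transpose_orthogonal:
  fixes V :: "real^'n^'n"
  assumes "V ** transpose V = mat 1"
  shows "norm (transpose V *v x) = norm x"
proof -
  have "(transpose V *v x) \<bullet> (transpose V *v x) = (V *v (transpose V *v x)) \<bullet> x"
    by (metis dot_lmul_matrix inner_commute transpose_matrix_vector)
  thus ?thesis
    by (simp add: norm_eq_sqrt_inner matrix_vector_mul_assoc assms del: transpose_matrix_vector)
qed

lemma objective_orthogonal_change:
  fixes V M :: "real^'n^'n"
  assumes "transpose V ** V = mat 1" and "V ** transpose V = mat 1"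
  shows "objective p \<beta> (transpose V ** M ** V) q (transpose V *v y) = objective p \<beta> M (V *v q) y"
proof -
  have "transpose V ** M ** V *v (transpose V *v y) = transpose V *v (M *v y)"
    using assms(2) by (metis matrix_vector_mul_assoc matrix_vector_mul_lid)
  hence "(transpose V *v y) \<bullet> (transpose V ** M ** V *v (transpose V *v y)) = y \<bullet> (M *v y)"
    using assms(2)
    by (metis dot_lmul_matrix matrix_vector_mul_assoc matrix_vector_mul_lid transpose_matrix_vector transpose_transpose)
  moreover have "transpose V *v y - q = transpose V *v (y - V *v q)"
    by (simp add: matrix_vector_mult_diff_distrib matrix_vector_mul_assoc assms(1))
  ultimately show ?thesis
    by (simp add: objective_def norm_transpose_orthogonal[OF assms(2)] del: transpose_matrix_vector)
qed

text \<open>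
  With \<open>c = \<lambda>\<^sub>2\<close> this replaces the spectrum \<open>(\<lambda>\<^sub>1, \<lambda>\<^sub>2)\<close> by \<open>(\<kappa>, 1)\<close>. Since the power has degree
  \<open>p / 2\<close> in the matrix, pulling the factor out of the whole objective rescales \<open>\<beta>\<close>.
\<close>
lemma objective_scale:
  assumes "c > 0"
  shows "objective p \<beta> (c *\<^sub>R M) q y = c powr (p / 2) * objective p (\<beta> / c powr (p / 2)) M q y"
proof -
  have "y \<bullet> ((c *\<^sub>R M) *v y) = c * (y \<bullet> (M *v y))"
    by (simp add: scaleR_matrix_vector_assoc[symmetric])
  thus ?thesis using assms by (simp add: objective_def powr_mult algebra_simps)
qed

text \<open>
  The comparison point \<open>x\<close> is the projection of \<open>y\<close> onto the box spanned by \<open>0\<close> and \<open>q\<close>. As the box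
  is convex and contains \<open>q\<close>, the angle at \<open>x\<close> between \<open>y\<close> and \<open>q\<close> is not acute, so replacing \<open>y\<close>
  by \<open>x\<close> lowers the squared distance to \<open>q\<close> by at least the squared distance of \<open>x\<close> and \<open>y\<close>.
\<close>
lemma minimiser_box:
  fixes q y :: "real^'n"
  assumes "p \<ge> 0" "\<beta> > 0" "\<And>i. d $ i \<ge> 0"
    and min: "\<And>x. objective p \<beta> (diag d) q y \<le> objective p \<beta> (diag d) q x"
  shows "y = vec_sign q * \<bar>y\<bar>" and "\<bar>y $ i\<bar> \<le> \<bar>q $ i\<bar>"
proof -
  define x :: "real^'n" where
    "x = (\<chi> i. sgn (q $ i) * min (if y $ i * q $ i > 0 then \<bar>y $ i\<bar> else 0) \<bar>q $ i\<bar>)"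
  have sq: "(x $ i)\<^sup>2 \<le> (y $ i)\<^sup>2" for i
    by (auto simp: x_def abs_mult sgn_if abs_le_square_iff[symmetric] abs_if)
  have "(\<Sum>i\<in>UNIV. d $ i * (x $ i)\<^sup>2) \<le> (\<Sum>i\<in>UNIV. d $ i * (y $ i)\<^sup>2)"
    using assms(3) sq by (intro sum_mono mult_left_mono)
  hence pw: "(x \<bullet> (diag d *v x)) powr (p / 2) \<le> (y \<bullet> (diag d *v y)) powr (p / 2)"
    unfolding inner_diag using assms(1,3) by (intro powr_mono2 sum_nonneg mult_nonneg_nonneg) auto
  have obtuse: "(x $ i - q $ i)\<^sup>2 + (y $ i - x $ i)\<^sup>2 \<le> (y $ i - q $ i)\<^sup>2" for i
  proof -
    have "(y $ i - x $ i) * (x $ i - q $ i) \<ge> 0"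
      by (auto simp: x_def sgn_if abs_if min_def zero_less_mult_iff mult_le_0_iff zero_le_mult_iff not_less)
    thus ?thesis by (simp add: power2_eq_square algebra_simps)
  qed
  have "(norm (x - q))\<^sup>2 + (norm (y - x))\<^sup>2 \<le> (norm (y - q))\<^sup>2"
    unfolding norm_diff_power2 sum.distrib[symmetric] by (intro sum_mono obtuse)
  moreover have "(norm (y - q))\<^sup>2 \<le> (norm (x - q))\<^sup>2"
    using min[of x] pw assms(2) unfolding objective_def
    by (smt (verit) half_gt_zero mult_le_cancel_left_pos)
  ultimately have "(norm (y - x))\<^sup>2 \<le> 0" by linarith
  hence "y = x" by simp
  hence yx: "y $ i = x $ i" for i by simp
  show "y = vec_sign q * \<bar>y\<bar>"
    unfolding vec_eq_iff
  proof
    fix i show "y $ i = (vec_sign q * \<bar>y\<bar>) $ i"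
      using yx[of i] by (auto simp: vec_sign_def x_def abs_vec_def times_vec_def sgn_if split: if_splits)
  qed
  show "\<bar>y $ i\<bar> \<le> \<bar>q $ i\<bar>"
    unfolding yx by (auto simp: x_def sgn_if abs_mult)
qed

text \<open>
  Where \<open>q\<close> vanishes, multiplication by the sign kills the component of \<open>z\<close>; everywhere else it is
  a reflection that carries \<open>\<bar>q\<bar>\<close> to \<open>q\<close> and preserves the diagonal form.
\<close>
lemma objective_diag_sign:
  fixes q z :: "real^'n"
  assumes "\<And>i. q $ i = 0 \<Longrightarrow> z $ i = 0"
  shows "objective p \<beta> (diag d) q (vec_sign q * z) = objective p \<beta> (diag d) \<bar>q\<bar> z"
proof -
  have 1: "((vec_sign q * z) $ i)\<^sup>2 = (z $ i)\<^sup>2" for i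
    using assms[of i] by (auto simp: vec_sign_def times_vec_def sgn_if)
  have 2: "((vec_sign q * z) $ i - q $ i)\<^sup>2 = (z $ i - \<bar>q\<bar> $ i)\<^sup>2" for i
    using assms[of i] by (auto simp: vec_sign_def times_vec_def abs_vec_def sgn_if abs_if power2_eq_square algebra_simps)
  show ?thesis by (simp only: objective_def inner_diag norm_diff_power2 1 2)
qed

text \<open>
  First-order condition along the level ellipse of the quadratic form through \<open>y\<close>. On this ellipse
  only the distance to \<open>q\<close> varies, and the equation says that \<open>y - q\<close> is parallel to the normal
  \<open>(\<kappa> y\<^sub>1, y\<^sub>2)\<close>.
\<close>
lemma minimiser_tangency:
  fixes q y :: "real^2"
  assumes "\<beta> > 0" "\<kappa> > 0"
    and min: "\<And>x. objective p \<beta> (diag (vector [\<kappa>, 1])) q y \<le> objective p \<beta> (diag (vector [\<kappa>, 1])) q x"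
  shows "\<kappa> * y $ 1 * (y $ 2 - q $ 2) = y $ 2 * (y $ 1 - q $ 1)"
proof -
  define k where "k = sqrt \<kappa>"
  have k: "k > 0" "\<kappa> = k * k" using assms(2) by (auto simp: k_def)
  \<comment> \<open>\<open>(a t, b t)\<close> runs through the ellipse, starting at \<open>y\<close>: it is \<open>y\<close> rotated by the angle \<open>t\<close>
    in the coordinates \<open>(k x\<^sub>1, x\<^sub>2)\<close>, in which the ellipse is a circle.\<close>
  define a where "a t = cos t * y $ 1 - sin t * (y $ 2 / k)" for t
  define b where "b t = cos t * y $ 2 + sin t * (k * y $ 1)" for t
  have ellipse: "\<kappa> * (a t)\<^sup>2 + (b t)\<^sup>2 = \<kappa> * (y $ 1)\<^sup>2 + (y $ 2)\<^sup>2" for t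
  proof -
    have ka: "k * a t = cos t * (k * y $ 1) - sin t * y $ 2"
      using k(1) by (simp add: a_def field_simps)
    have "(k * a t)\<^sup>2 + (b t)\<^sup>2 = ((cos t)\<^sup>2 + (sin t)\<^sup>2) * ((k * y $ 1)\<^sup>2 + (y $ 2)\<^sup>2)"
      unfolding ka b_def by algebra
    hence "(k * a t)\<^sup>2 + (b t)\<^sup>2 = (k * y $ 1)\<^sup>2 + (y $ 2)\<^sup>2"
      by (simp only: sin_cos_squared_add2 mult_1)
    thus ?thesis by (simp add: k(2) power2_eq_square mult_ac)
  qed
  define D where "D t = (a t - q $ 1)\<^sup>2 + (b t - q $ 2)\<^sup>2" for t
  have le: "D 0 \<le> D t" for t
    using min[of "vector [a t, b t]"] assms(1) ellipse[of t]
    by (simp add: objective_def inner_diag norm_diff_power2 sum_2 D_def a_def b_def)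
  have "(D has_real_derivative
      2 * (y $ 1 - q $ 1) * (- (y $ 2 / k)) + 2 * (y $ 2 - q $ 2) * (k * y $ 1)) (at 0)"
    unfolding D_def a_def b_def using k(1)
    by (auto intro!: derivative_eq_intros simp: algebra_simps diff_divide_distrib)
  from DERIV_local_min[OF this, of 1] le
  have "2 * (y $ 1 - q $ 1) * (- (y $ 2 / k)) + 2 * (y $ 2 - q $ 2) * (k * y $ 1) = 0"
    by auto
  thus ?thesis using k by (simp add: field_simps)
qed

theorem proposition6p3:
  fixes p \<beta> \<kappa> lam\<^sub>1 lam\<^sub>2 \<beta>bar c\<^sub>1 c\<^sub>2 :: real
    and q qtilde s qbar tstar :: "real^2"
    and A V \<Lambda> \<Lambda>bar :: "real^2^2"
    and F H :: "real^2 \<Rightarrow> real"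
    and H\<^sub>1 :: "(real^2) set"
  assumes "p > 0" and "\<beta> > 0"
    and "sym_pos_def A"
    and "\<kappa> > 1"
    and "A = transpose V ** \<Lambda> ** V"
    and "transpose V ** V = mat 1" and "V ** transpose V = mat 1"
    and "\<Lambda> = diag (vector [lam\<^sub>1, lam\<^sub>2])"
    and "lam\<^sub>1 > lam\<^sub>2" and "lam\<^sub>2 > 0"
    and "qtilde = V *v q"
    and "s = vec_sign qtilde"
    and "qbar = \<bar>qtilde\<bar>"
    and "\<beta>bar = \<beta> / lam\<^sub>2 powr (p / 2)"
    and "\<Lambda>bar = diag (vector [\<kappa>, 1])"
    and "\<kappa> = lam\<^sub>1 / lam\<^sub>2"
    and "F = objective p \<beta> A q"
    and "H = objective p \<beta>bar \<Lambda>bar qbar"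
    and "c\<^sub>1 = - (qbar $ 1 / (\<kappa> - 1))"
    and "c\<^sub>2 = \<kappa> * qbar $ 2 / (\<kappa> - 1)"
    and "H\<^sub>1 = hyperbola c\<^sub>1 c\<^sub>2 \<inter> {z. z $ 1 \<in> {0..qbar $ 1} \<and> z $ 2 \<in> {0..qbar $ 2}}"
    and "is_arg_min F (\<lambda>t. t \<in> UNIV) tstar"
  shows "\<exists>zstar. is_arg_min H (\<lambda>z. z \<in> H\<^sub>1) zstar \<and> tstar = transpose V *v (s * zstar)"
proof -
  note p = assms(1) and \<beta> = assms(2) and \<kappa> = assms(4) and lam\<^sub>2 = assms(10)
  note A = assms(5) and V = assms(6,7)
  note qtilde = assms(11) and s = assms(12) and qbar = assms(13)
  note F = assms(17) and H = assms(18) and H\<^sub>1 = assms(21) and tstar_min = assms(22)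
  define G where "G = objective p \<beta>bar \<Lambda>bar qtilde"
  define y where "y = V *v tstar"
  define z where "z = \<bar>y\<bar>"
  have tstar: "tstar = transpose V *v y"
    by (simp add: y_def matrix_vector_mul_assoc V(1))
  have \<Lambda>: "\<Lambda> = lam\<^sub>2 *\<^sub>R \<Lambda>bar"
    using lam\<^sub>2 unfolding assms(8,15,16)
    by (auto simp: diag_def vec_eq_iff forall_2)
  have FG: "F (transpose V *v x) = lam\<^sub>2 powr (p / 2) * G x" for x
    unfolding F A G_def objective_orthogonal_change[OF V] \<Lambda>
      qtilde[symmetric] assms(14)
    by (rule objective_scale[OF lam\<^sub>2])
  have Gmin: "G y \<le> G x" for x
  proof -
    have "F tstar \<le> F (transpose V *v x)"
      using tstar_min by (auto simp: is_arg_min_def not_less)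
    thus ?thesis using lam\<^sub>2 by (simp add: tstar FG del: transpose_matrix_vector)
  qed
  have \<beta>bar: "\<beta>bar > 0" using \<beta> lam\<^sub>2 assms(14) by simp
  have \<kappa>nonneg: "(vector [\<kappa>, 1] :: real^2) $ i \<ge> 0" for i
    using \<kappa> exhaust_2[of i] by auto
  note box = minimiser_box[OF less_imp_le[OF p] \<beta>bar \<kappa>nonneg,
      OF Gmin[unfolded G_def assms(15)]]
  have y: "y = s * z" using box(1) by (simp add: z_def s)
  have zbox: "0 \<le> z $ i" "z $ i \<le> qbar $ i" for i
    using box(2)[of i] by (simp_all add: z_def qbar abs_vec_def)
  have GH: "G (s * w) = H w" if "\<And>i. 0 \<le> w $ i" "\<And>i. w $ i \<le> qbar $ i" for w
    unfolding G_def s qbar assms(15) H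
  proof (rule objective_diag_sign)
    fix i assume "qtilde $ i = 0"
    thus "w $ i = 0" using that[of i] by (simp add: qbar abs_vec_def)
  qed
  have tangent: "\<kappa> * y $ 1 * (y $ 2 - qtilde $ 2) = y $ 2 * (y $ 1 - qtilde $ 1)"
    using minimiser_tangency[OF \<beta>bar _ Gmin[unfolded G_def assms(15)]] \<kappa> by simp
  have comp: "y $ i = sgn (qtilde $ i) * z $ i" "qtilde $ i = sgn (qtilde $ i) * qbar $ i" for i
    by (simp_all add: y s qbar vec_sign_def times_vec_def abs_vec_def sgn_mult_abs)
  have "\<kappa> * z $ 1 * (z $ 2 - qbar $ 2) = z $ 2 * (z $ 1 - qbar $ 1)"
  proof (cases "qtilde $ 1 = 0 \<or> qtilde $ 2 = 0")
    case True
    \<comment> \<open>The tangency equation of \<open>y\<close> degenerates if a sign is \<open>0\<close>, but then the box forces the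
      same component of \<open>z\<close> to vanish, and both sides are \<open>0\<close>.\<close>
    hence "(qbar $ 1 = 0 \<and> z $ 1 = 0) \<or> (qbar $ 2 = 0 \<and> z $ 2 = 0)"
      using zbox[of 1] zbox[of 2] by (auto simp: qbar abs_vec_def)
    thus ?thesis by auto
  next
    case False
    have "sgn (qtilde $ 1) * sgn (qtilde $ 2) * (\<kappa> * z $ 1 * (z $ 2 - qbar $ 2))
        = sgn (qtilde $ 1) * sgn (qtilde $ 2) * (z $ 2 * (z $ 1 - qbar $ 1))"
      using tangent[unfolded comp(1)] comp(2)[of 1] comp(2)[of 2]
      by (smt (verit) mult.assoc mult.commute right_diff_distrib)
    thus ?thesis using False by (simp add: sgn_eq_0_iff)
  qed
  moreover have "c\<^sub>1 * (\<kappa> - 1) = - qbar $ 1" "c\<^sub>2 * (\<kappa> - 1) = \<kappa> * qbar $ 2"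
    using \<kappa> by (simp_all add: assms(19,20))
  ultimately have "(\<kappa> - 1) * (z $ 1 * z $ 2) = (\<kappa> - 1) * (c\<^sub>1 * z $ 2 + c\<^sub>2 * z $ 1)"
    by algebra
  hence "z $ 1 * z $ 2 = c\<^sub>1 * z $ 2 + c\<^sub>2 * z $ 1"
    using \<kappa> by simp
  hence "z \<in> hyperbola c\<^sub>1 c\<^sub>2"
    by (simp add: hyperbola_def algebra_simps)
  hence zH1: "z \<in> H\<^sub>1" using zbox by (simp add: H\<^sub>1)
  have "H z \<le> H w" if "w \<in> H\<^sub>1" for w
  proof -
    have "0 \<le> w $ i \<and> w $ i \<le> qbar $ i" for i
      using that exhaust_2[of i] by (auto simp: H\<^sub>1)
    thus ?thesis using Gmin[of "s * w"] GH[of w] GH[of z] zbox by (simp add: y)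
  qed
  hence "is_arg_min H (\<lambda>z. z \<in> H\<^sub>1) z"
    using zH1 by (auto simp: is_arg_min_def not_less)
  thus ?thesis using tstar y by auto
qed

end
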